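(* Let $K$ and $L$ be topological fields, and let $X$ and $Y$ be vector spaces over $K$ and $L$, respectively, with $\dim_K X\geq 2$. Suppose that there is a lattice isomorphism $\Phi:\Sigma(X)\rightarrow\Sigma(Y)$ with $\Phi(\tau_K(X))=\tau_L(Y)$. Then there exists a unique triple $(\psi,\phi,y_0)$ consisting of an isomorphism $\psi:K\rightarrow L$ of topological fields, a $\psi$-semilinear isomorphism $\phi:X\rightarrow Y$ and an element $y_0\in Y$ such that (i) if $|X|$ is infinite, then $\Phi=(\phi+y_0)_*$, and (ii) if $|X|$ is finite, then $\Phi=(\phi+y_0)_*$ or $\Phi=C\circ(\phi+y_0)_*$.
   Context: A topological field is a field $K$ endowed with a Hausdorff topology such that addition $K\times K\to K$, multiplication $K\times K\to K$, and inversion $K\setminus\{0\}\to K\setminus\{0\}$ are continuous (product and relative topologies). An isomorphism of topological fields is a field isomorphism that is also a homeomorphism. For a non-empty set $X$, $\Sigma(X)$ is the set of all topologies on $X$ (each topology viewed as its family of open sets), ordered by inclusion $\subset$; it is a complete lattice. A lattice isomorphism is a bijection preserving joins and meets (equivalently, a bijection which, together with its inverse, preserves the order). A vector topology on a vector space $X$ over a topological field $K$ is a (not necessarily Hausdorff) topology on $X$ for which addition $X\times X\to X$ and scalar multiplication $K\times X\to X$ are continuous (product topologies). $\tau_K(X)\subset\Sigma(X)$ denotes the set of all vector topologies on the $K$-vector space $X$. Vector spaces may be infinite-dimensional. For a map $f:X\to Y$ of sets, $f_*:\Sigma(X)\to\Sigma(Y)$ is defined by $f_*(T)=\{V\subset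 Y\mid f^{-1}(V)\in T\}$. For a finite set $Y$, the complement map $C:\Sigma(Y)\to\Sigma(Y)$ is $C(T)=\{Y\setminus U\mid U\in T\}$. For a field isomorphism $\psi:K\to L$, a $\psi$-semilinear isomorphism $\phi:X\to Y$ is a bijection with $\phi(x_1+x_2)=\phi(x_1)+\phi(x_2)$ and $\phi(\alpha x)=\psi(\alpha)\phi(x)$ for all $x_1,x_2,x\in X$, $\alpha\in K$. The map $\phi+y_0:X\to Y$ is $x\mapsto\phi(x)+y_0$. *)

theory Defs
  imports "HOL-Analysis.Analysis"
begin

class topological_field = field + t2_space + topological_monoid_add + topological_semigroup_mult +
  assumes tendsto_inverse_nhds: "a \<noteq> 0 \<Longrightarrow> (inverse \<longlongrightarrow> inverse a) (nhds a)"

lemma topological_field_continuous: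
  shows "continuous_on UNIV (\<lambda>(x, y). x + y :: 'k::topological_field)"
    and "continuous_on UNIV (\<lambda>(x, y). x * y :: 'k)"
    and "continuous_on (- {0}) (inverse :: 'k \<Rightarrow> 'k)"
proof -
  show "continuous_on UNIV (\<lambda>(x, y). x + y :: 'k)"
    unfolding case_prod_unfold continuous_on_def
    by (intro ballI tendsto_intros)
  show "continuous_on UNIV (\<lambda>(x, y). x * y :: 'k)"
    unfolding case_prod_unfold continuous_on_def
    by (intro ballI filterlim_compose[OF tendsto_mult_Pair filterlim_Pair, simplified] tendsto_intros)
  show "continuous_on (- {0}) (inverse :: 'k \<Rightarrow> 'k)"
    unfolding continuous_on_def
    by (auto simp: at_within_def intro!: tendsto_mono[OF _ tendsto_inverse_nhds])
qed

definition topological_field_iso :: "('k::topological_field \<Rightarrow> 'l::topological_field) \<Rightarrow> bool" where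
  "topological_field_iso \<psi> \<longleftrightarrow>
     bij \<psi> \<and> \<psi> 1 = 1 \<and>
     (\<forall>a b. \<psi> (a + b) = \<psi> a + \<psi> b) \<and>
     (\<forall>a b. \<psi> (a * b) = \<psi> a * \<psi> b) \<and>
     homeomorphic_map euclidean euclidean \<psi>"

text \<open>A topology on the whole type is represented by its family of open sets, so that the order
  is plain inclusion of families.\<close>

definition topologies :: "'x set set set" where
  "topologies = {T. istopology (\<lambda>U. U \<in> T) \<and> UNIV \<in> T}"

abbreviation top_space :: "'x set set \<Rightarrow> 'x topology" where
  "top_space T \<equiv> topology (\<lambda>U. U \<in> T)"

text \<open>In the lattice of topologies the meet of two elements is their intersection, and their join
  is the topology generated by their union; see \<open>topology_meet\<close> and \<open>topology_join\<close> below.\<close>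

definition join_top :: "'x set set \<Rightarrow> 'x set set \<Rightarrow> 'x set set" where
  "join_top S T = {U. generate_topology (S \<union> T) U}"

definition topologies_lattice_iso :: "('x set set \<Rightarrow> 'y set set) \<Rightarrow> bool" where
  "topologies_lattice_iso \<Phi> \<longleftrightarrow>
     bij_betw \<Phi> topologies topologies \<and>
     (\<forall>S\<in>topologies. \<forall>T\<in>topologies.
        \<Phi> (S \<inter> T) = \<Phi> S \<inter> \<Phi> T \<and> \<Phi> (join_top S T) = join_top (\<Phi> S) (\<Phi> T))"

definition vector_topologies ::
    "('k::topological_field \<Rightarrow> 'x::ab_group_add \<Rightarrow> 'x) \<Rightarrow> 'x set set set" where
  "vector_topologies scl = {T \<in> topologies.
     continuous_map (prod_topology (top_space T) (top_space T)) (top_space T) (\<lambda>(x, y). x + y) \<and>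
     continuous_map (prod_topology euclidean (top_space T)) (top_space T) (\<lambda>(a, x). scl a x)}"

text \<open>The library's \<open>dim\<close> is 0 for spaces without a finite basis, hence a definition that also
  covers infinite dimension.\<close>

definition dim_at_least :: "nat \<Rightarrow> ('k::field \<Rightarrow> 'x::ab_group_add \<Rightarrow> 'x) \<Rightarrow> bool" where
  "dim_at_least n scl \<longleftrightarrow>
     (\<exists>B. \<not> module.dependent scl B \<and> module.span scl B = UNIV \<and> (infinite B \<or> n \<le> card B))"

definition pushforward :: "('x \<Rightarrow> 'y) \<Rightarrow> 'x set set \<Rightarrow> 'y set set" where
  "pushforward f T = {V. f -` V \<in> T}"

definition complement_top :: "'y set set \<Rightarrow> 'y set set" where
  "complement_top T = {UNIV - U | U. U \<in> T}"

definition semilinear_iso ::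
    "('k::field \<Rightarrow> 'x::ab_group_add \<Rightarrow> 'x) \<Rightarrow> ('l::field \<Rightarrow> 'y::ab_group_add \<Rightarrow> 'y) \<Rightarrow>
     ('k \<Rightarrow> 'l) \<Rightarrow> ('x \<Rightarrow> 'y) \<Rightarrow> bool" where
  "semilinear_iso scaleX scaleY \<psi> \<phi> \<longleftrightarrow>
     bij \<phi> \<and>
     (\<forall>x1 x2. \<phi> (x1 + x2) = \<phi> x1 + \<phi> x2) \<and>
     (\<forall>a x. \<phi> (scaleX a x) = scaleY (\<psi> a) (\<phi> x))"

lemma topology_meet:
  assumes "S \<in> topologies" "T \<in> topologies"
  shows "S \<inter> T \<in> topologies"
  using assms by (simp add: topologies_def istopology_def)

lemma generate_topology_least:
  assumes "R \<in> topologies" "G \<subseteq> R" "generate_topology G U"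
  shows "U \<in> R"
  using assms(3)
proof induction
  case (UN K)
  have "\<forall>K. (\<forall>S\<in>K. S \<in> R) \<longrightarrow> \<Union>K \<in> R"
    using assms(1) by (simp add: topologies_def istopology_def)
  with UN.IH show ?case by blast
next
  case (Int a b)
  then show ?case using assms(1) by (simp add: topologies_def istopology_def)
qed (use assms in \<open>auto simp: topologies_def\<close>)

lemma topology_join:
  shows "join_top S T \<in> topologies" and "S \<subseteq> join_top S T" and "T \<subseteq> join_top S T"
    and "\<lbrakk>R \<in> topologies; S \<subseteq> R; T \<subseteq> R\<rbrakk> \<Longrightarrow> join_top S T \<subseteq> R"
proof -
  show "join_top S T \<in> topologies"
    unfolding topologies_def istopology_def join_top_def
    by (auto intro: generate_topology.intros)
  show "S \<subseteq> join_top S T" "T \<subseteq> join_top S T"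
    by (auto simp: join_top_def intro: generate_topology.Basis)
  show "join_top S T \<subseteq> R" if "R \<in> topologies" "S \<subseteq> R" "T \<subseteq> R"
    using that generate_topology_least[of R "S \<union> T"] by (auto simp: join_top_def)
qed

end

theory Submission
  imports Defs
begin

text \<open>
  The proof has a set-theoretic half and a linear half.

  The set-theoretic half is Hartmanis' description of the isomorphisms between lattices of
  topologies. The atoms of the lattice are the topologies \<open>{\<emptyset>, A, X}\<close>, and a topology is determined
  by the atoms below it. So a lattice isomorphism \<open>\<Phi>\<close> is the same thing as a bijection \<open>F\<close>
  from the subsets of \<open>X\<close> to those of \<open>Y\<close> such that a family of sets is a topology iff its image
  under \<open>F\<close> is one. The family \<open>{\<emptyset>, A, B, X}\<close> is a topology iff \<open>A\<close> and \<open>B\<close> are comparable or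
  complementary. When \<open>X\<close> has at least four points, complementary pairs are recognized as those for
  which no third proper nonempty subset is related to both in this way, so \<open>F\<close> preserves comparability. The
  topology generated by two incomparable sets has only their union and their intersection as
  further members besides \<open>\<emptyset>\<close> and \<open>X\<close>, which forces \<open>F\<close> to treat all inclusions alike: on proper nonempty
  sets it either preserves or reverses all of them. It follows that \<open>F\<close> is \<open>A \<mapsto> f(A)\<close> or \<open>A \<mapsto> Y - f(A)\<close>
  for a bijection \<open>f\<close>. The second kind would carry the cofinite topology to a family whose proper
  members are the finite sets; this is not a topology on an infinite set, so the second kind occurs
  for finite \<open>X\<close> only
  (\<^emph>\<open>topologies_lattice_iso_cases\<close>). There it can be
  ignored on vector topologies: a finite vector topology is generated by the cosets of a subspace,
  so it is closed under complements.

  In the linear half \<open>f\<close> carries vector topologies to vector topologies in both directions. In a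
  vector topology the intersection of the neighbourhoods of a point \<open>x\<close> is the coset \<open>x + N\<close> of a
  subspace \<open>N\<close>. The topology induced by a linear functional \<open>h\<close> is a
  vector topology, and here \<open>N\<close> is the kernel of \<open>h\<close>, because the field is Hausdorff. So \<open>f\<close> maps the
  cosets of a hyperplane to the cosets of one subspace; as every line is an intersection of
  hyperplanes, \<open>f\<close> maps parallel lines to parallel lines, and in dimension at least 2 this makes it
  semilinear up to a translation. Finally, the topology of the field can be read off from the
  topology induced by a functional \<open>h\<close>: if \<open>O\<close> is open in \<open>K\<close>, the image under \<open>f\<close> of the preimage of \<open>O\<close> under \<open>h\<close>
  is open in a vector topology on \<open>Y\<close>, and its trace on a suitable line is \<open>\<psi>(O)\<close>. Hence \<open>\<psi>\<close> and its
  inverse are open (\<^emph>\<open>vector_topology_bijection_affine\<close>).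
\<close>

section \<open>Topologies generated by one or two open sets\<close>

lemma topologies_empty: "T \<in> topologies \<Longrightarrow> {} \<in> T"
  and topologies_UNIV: "T \<in> topologies \<Longrightarrow> UNIV \<in> T"
  and topologies_Int: "T \<in> topologies \<Longrightarrow> U \<in> T \<Longrightarrow> V \<in> T \<Longrightarrow> U \<inter> V \<in> T"
  and topologies_Union: "T \<in> topologies \<Longrightarrow> \<K> \<subseteq> T \<Longrightarrow> \<Union>\<K> \<in> T"
  unfolding topologies_def istopology_def
  by (auto dest: spec[where x = "{}"])

lemma topologies_Un: "T \<in> topologies \<Longrightarrow> U \<in> T \<Longrightarrow> V \<in> T \<Longrightarrow> U \<union> V \<in> T"
  using topologies_Union[of T "{U, V}"] by simp

lemma finite_topologiesI:
  assumes "finite T" "{} \<in> T" "UNIV \<in> T"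
    and Int: "\<And>U V. U \<in> T \<Longrightarrow> V \<in> T \<Longrightarrow> U \<inter> V \<in> T"
    and Un: "\<And>U V. U \<in> T \<Longrightarrow> V \<in> T \<Longrightarrow> U \<union> V \<in> T"
  shows "T \<in> topologies"
proof -
  have "\<Union>\<K> \<in> T" if "\<K> \<subseteq> T" for \<K>
  proof -
    have "finite \<K>" using that assms(1) by (rule finite_subset)
    then show ?thesis using that by induction (auto simp: assms(2) Un)
  qed
  then show ?thesis
    using assms(3) Int unfolding topologies_def istopology_def by blast
qed

definition atom_top :: "'x set \<Rightarrow> 'x set set" where
  "atom_top A = {{}, A, UNIV}"

lemma atom_top_topologies: "atom_top A \<in> topologies"
  unfolding atom_top_def by (rule finite_topologiesI) auto

lemma atom_top_subset_iff: "T \<in> topologies \<Longrightarrow> atom_top A \<subseteq> T \<longleftrightarrow> A \<in> T"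
  by (auto simp: atom_top_def topologies_empty topologies_UNIV)

text \<open>The right-hand side speaks of the order of the lattice only, so it is invariant under lattice
  isomorphisms. It is satisfied by the bottom element too, which is \<open>atom_top {}\<close>.\<close>

lemma atom_top_characterization:
  assumes T: "T \<in> topologies"
  shows "(\<exists>A. T = atom_top A) \<longleftrightarrow>
    (\<forall>S\<in>topologies. S \<subseteq> T \<longrightarrow> S = T \<or> (\<forall>R\<in>topologies. S \<subseteq> R))" (is "_ \<longleftrightarrow> ?small T")
proof
  assume "\<exists>A. T = atom_top A"
  then obtain A where A: "T = atom_top A" by blast
  show "?small T"
  proof (intro ballI impI)
    fix S assume S: "S \<in> topologies" "S \<subseteq> T"
    show "S = T \<or> (\<forall>R\<in>topologies. S \<subseteq> R)"
    proof (cases "A \<in> S")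
      case True
      then show ?thesis using S A atom_top_subset_iff by blast
    next
      case False
      then have "S \<subseteq> {{}, UNIV}" using S A by (auto simp: atom_top_def)
      then show ?thesis using topologies_empty topologies_UNIV by blast
    qed
  qed
next
  assume small: "?small T"
  show "\<exists>A. T = atom_top A"
  proof (cases "T = {{}, UNIV}")
    case True
    then show ?thesis by (auto simp: atom_top_def intro: exI[of _ "{}"])
  next
    case False
    then obtain A where A: "A \<in> T" "A \<noteq> {}" "A \<noteq> UNIV"
      using topologies_empty[OF T] topologies_UNIV[OF T] by blast
    have "\<not> atom_top A \<subseteq> atom_top {}" using A by (auto simp: atom_top_def)
    then have "atom_top A = T"
      using small A atom_top_subset_iff[OF T] atom_top_topologies by metis
    then show ?thesis by blast
  qed
qed

lemma atom_top_eq: "atom_top A = atom_top B \<Longrightarrow> A = B \<or> A \<in> {{}, UNIV} \<and> B \<in> {{}, UNIV}"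
proof -
  assume eq: "atom_top A = atom_top B"
  have "A \<in> atom_top A" "B \<in> atom_top B" by (simp_all add: atom_top_def)
  then have "A \<in> atom_top B" "B \<in> atom_top A" using eq by simp_all
  then show ?thesis unfolding atom_top_def by blast
qed

definition pair_top :: "'x set \<Rightarrow> 'x set \<Rightarrow> 'x set set" where
  "pair_top A B = {{}, UNIV, A, B, A \<inter> B, A \<union> B}"

lemma pair_top_topologies: "pair_top A B \<in> topologies"
proof (rule finite_topologiesI)
  fix U V assume "U \<in> pair_top A B" "V \<in> pair_top A B"
  then show "U \<inter> V \<in> pair_top A B" "U \<union> V \<in> pair_top A B"
    unfolding pair_top_def
    by (elim insertE emptyE; hypsubst; simp add: Int_absorb1 Int_absorb2 Un_absorb1 Un_absorb2
        le_infI1 le_infI2 le_supI1 le_supI2 Int_commute Un_commute)+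
qed (simp_all add: pair_top_def)

section \<open>Lattice isomorphisms act on open sets\<close>

text \<open>An open set \<open>U\<close> of \<open>T\<close> is recognized by \<open>atom_top U \<subseteq> T\<close>, and \<open>\<Phi>\<close> permutes the families of the
  form \<open>atom_top A\<close>; this defines \<open>F\<close> on proper nonempty sets. The sets \<open>{}\<close> and \<open>UNIV\<close> give the same
  family, so their images are prescribed by hand.\<close>

lemma lattice_iso_acts_on_open_sets:
  fixes \<Phi> :: "'x set set \<Rightarrow> 'y set set"
  assumes iso: "topologies_lattice_iso \<Phi>"
  obtains F :: "'x set \<Rightarrow> 'y set"
  where "bij F" "F {} = {}" "F UNIV = UNIV"
    and "\<And>T. T \<in> topologies \<Longrightarrow> \<Phi> T = F ` T"
    and "\<And>T. F ` T \<in> topologies \<longleftrightarrow> T \<in> topologies"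
proof -
  have bij: "bij_betw \<Phi> topologies topologies" using iso by (simp add: topologies_lattice_iso_def)
  have top: "\<Phi> T \<in> topologies" if "T \<in> topologies" for T
    using bij that by (auto simp: bij_betw_def)
  have eq: "\<Phi> S = \<Phi> T \<longleftrightarrow> S = T" if "S \<in> topologies" "T \<in> topologies" for S T
    using bij that by (auto simp: bij_betw_def inj_on_def)
  have sur: "\<exists>S\<in>topologies. T = \<Phi> S" if "T \<in> topologies" for T
    using bij that by (auto simp: bij_betw_def)
  have ord: "\<Phi> S \<subseteq> \<Phi> T \<longleftrightarrow> S \<subseteq> T" if ST: "S \<in> topologies" "T \<in> topologies" for S T
  proof -
    have "\<Phi> (S \<inter> T) = \<Phi> S \<inter> \<Phi> T" using iso ST by (simp add: topologies_lattice_iso_def)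
    then show ?thesis using eq[OF topology_meet[OF ST] ST(1)] by blast
  qed
  have small: "(\<exists>B. \<Phi> T = atom_top B) \<longleftrightarrow> (\<exists>A. T = atom_top A)" if T: "T \<in> topologies" for T
  proof -
    have "(\<forall>S\<in>topologies. S \<subseteq> \<Phi> T \<longrightarrow> S = \<Phi> T \<or> (\<forall>R\<in>topologies. S \<subseteq> R)) \<longleftrightarrow>
          (\<forall>S\<in>topologies. \<Phi> S \<subseteq> \<Phi> T \<longrightarrow> \<Phi> S = \<Phi> T \<or> (\<forall>R\<in>topologies. \<Phi> S \<subseteq> \<Phi> R))"
      using sur top by metis
    also have "\<dots> \<longleftrightarrow> (\<forall>S\<in>topologies. S \<subseteq> T \<longrightarrow> S = T \<or> (\<forall>R\<in>topologies. S \<subseteq> R))"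
      using ord eq T by auto
    finally show ?thesis
      unfolding atom_top_characterization[OF T] atom_top_characterization[OF top[OF T]] .
  qed
  have "\<forall>A. \<exists>B. \<Phi> (atom_top A) = atom_top B"
    using small atom_top_topologies by blast
  then obtain F0 where F0: "\<And>A. \<Phi> (atom_top A) = atom_top (F0 A)" by metis
  define F where "F A = (if A = {} then {} else if A = UNIV then UNIV else F0 A)" for A
  have F_empty: "F {} = {}" and F_UNIV: "F UNIV = UNIV" by (auto simp: F_def)
  have bot: "\<Phi> (atom_top {}) = atom_top {}"
  proof -
    obtain S where "S \<in> topologies" "atom_top {} = \<Phi> S" using sur atom_top_topologies by blast
    moreover have "atom_top {} \<subseteq> S"
      using calculation by (simp add: atom_top_subset_iff topologies_empty)
    ultimately have "\<Phi> (atom_top {}) \<subseteq> atom_top {}" using ord atom_top_topologies by metis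
    moreover have "atom_top {} \<subseteq> \<Phi> (atom_top {})"
      by (simp add: atom_top_subset_iff atom_top_topologies top topologies_empty)
    ultimately show ?thesis by blast
  qed
  have trivial: "atom_top UNIV = atom_top {}" by (auto simp: atom_top_def)
  have F: "\<Phi> (atom_top A) = atom_top (F A)" for A
    by (simp add: F_def bot trivial flip: F0)
  have key: "F U \<in> \<Phi> T \<longleftrightarrow> U \<in> T" if "T \<in> topologies" for U T
    using that ord[of "atom_top U" T] by (simp add: F atom_top_subset_iff top atom_top_topologies)
  have inj: "inj F"
  proof (rule injI)
    fix A B assume AB: "F A = F B"
    then have "atom_top A = atom_top B" using F eq atom_top_topologies by metis
    then show "A = B" using atom_top_eq[of A B] AB F_empty F_UNIV by auto
  qed
  have surj: "\<exists>A. B = F A" for B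
  proof -
    obtain S where S: "S \<in> topologies" "atom_top B = \<Phi> S" using sur atom_top_topologies by blast
    then obtain A where "S = atom_top A" using small by metis
    then have "atom_top B = atom_top (F A)" using S F by simp
    then have "B = F A \<or> B = {} \<or> B = UNIV" using atom_top_eq by blast
    then show ?thesis using F_empty F_UNIV by metis
  qed
  have image: "\<Phi> T = F ` T" if "T \<in> topologies" for T
    using key[OF that] surj by (auto simp: image_iff) (metis surj)
  have "F ` T \<in> topologies \<longleftrightarrow> T \<in> topologies" for T
  proof
    assume "F ` T \<in> topologies"
    then obtain S where "S \<in> topologies" "F ` T = F ` S" using sur image by metis
    then show "T \<in> topologies" using inj by (simp add: inj_image_eq_iff)
  qed (use image top in metis)
  then show thesis using that inj surj F_empty F_UNIV image by (metis bijI surjI surj_def)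
qed

section \<open>Bijections of power sets that preserve topologies\<close>

text \<open>The last two assumptions exclude at most three points. With three points a chain
  \<open>{a} \<subset> {a, b}\<close> meets the criterion by which complements are recognized below.\<close>

locale topology_preserving =
  fixes F :: "'x set \<Rightarrow> 'y set"
  assumes bij: "bij F"
    and F_empty: "F {} = {}"
    and F_UNIV: "F UNIV = UNIV"
    and topologies_iff: "F ` T \<in> topologies \<longleftrightarrow> T \<in> topologies"
    and large_dom: "(UNIV :: 'x set) \<noteq> {a, b, c}"
    and large_cod: "(UNIV :: 'y set) \<noteq> {a', b', c'}"
begin

lemma F_eq: "F A = F B \<longleftrightarrow> A = B"
  using bij by (simp add: bij_def inj_eq)

lemma F_proper: "F A = {} \<longleftrightarrow> A = {}" "F A = UNIV \<longleftrightarrow> A = UNIV"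
  using F_eq F_empty F_UNIV by metis+

lemma F_surj: obtains A where "B = F A"
  using bij by (metis bij_pointE)

end

definition linked :: "'x set \<Rightarrow> 'x set \<Rightarrow> bool" where
  "linked A B \<longleftrightarrow> {{}, UNIV, A, B} \<in> topologies"

lemma linked_iff: "linked A B \<longleftrightarrow> A \<subseteq> B \<or> B \<subseteq> A \<or> B = - A"
proof
  assume l: "linked A B"
  have "A \<inter> B \<in> {{}, UNIV, A, B}" "A \<union> B \<in> {{}, UNIV, A, B}"
    using topologies_Int[OF l[unfolded linked_def], of A B]
      topologies_Un[OF l[unfolded linked_def], of A B] by auto
  then show "A \<subseteq> B \<or> B \<subseteq> A \<or> B = - A" by auto
next
  assume "A \<subseteq> B \<or> B \<subseteq> A \<or> B = - A"
  then show "linked A B"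
    unfolding linked_def by (intro finite_topologiesI) auto
qed

text \<open>No proper nonempty set is comparable to both \<open>A\<close> and \<open>- A\<close>. A chain \<open>A \<subset> B\<close> always leaves room
  for a further member below, between or above, unless there are only three points.\<close>

lemma complement_iff_linked:
  fixes A B :: "'x set"
  assumes large: "\<And>a b c. (UNIV :: 'x set) \<noteq> {a, b, c}"
    and A: "A \<noteq> {}" "A \<noteq> UNIV" and B: "B \<noteq> {}" "B \<noteq> UNIV"
  shows "B = - A \<longleftrightarrow> A \<noteq> B \<and> linked A B \<and>
    (\<forall>C. linked A C \<and> linked B C \<longrightarrow> C \<in> {{}, UNIV, A, B})"
proof -
  have chain: "\<exists>C. linked A C \<and> linked B C \<and> C \<notin> {{}, UNIV, A, B}"
    if AB: "A \<subset> B" "A \<noteq> {}" "B \<noteq> UNIV" for A B :: "'x set"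
  proof (rule ccontr)
    assume none: "\<not> ?thesis"
    obtain a b c where abc: "a \<in> A" "b \<in> B" "b \<notin> A" "c \<notin> B" using AB by blast
    have "{a} = A"
    proof (rule ccontr)
      assume "{a} \<noteq> A"
      moreover have "linked A {a}" "linked B {a}"
        using abc AB by (auto simp: linked_iff)
      moreover have "{a} \<notin> {{}, UNIV, B}" using abc AB by auto
      ultimately show False using none by blast
    qed
    moreover have "A \<union> {b} = B"
    proof (rule ccontr)
      assume "A \<union> {b} \<noteq> B"
      moreover have "linked A (A \<union> {b})" "linked B (A \<union> {b})"
        using abc AB by (auto simp: linked_iff)
      moreover have "A \<union> {b} \<notin> {{}, UNIV, A}" using abc AB by auto
      ultimately show False using none by blast
    qed
    moreover have "- {c} = B"
    proof (rule ccontr)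
      assume "- {c} \<noteq> B"
      moreover have "linked A (- {c})" "linked B (- {c})"
        using abc AB by (auto simp: linked_iff)
      moreover have "- {c} \<notin> {{}, UNIV, A}" using abc AB by auto
      ultimately show False using none by blast
    qed
    ultimately have "UNIV = {a, b, c}" by auto
    then show False using large by blast
  qed
  show ?thesis
  proof
    assume "B = - A"
    moreover have "C \<in> {{}, UNIV, A, - A}" if "linked A C" "linked (- A) C" for C
      using that A unfolding linked_iff by blast
    ultimately show "A \<noteq> B \<and> linked A B \<and>
        (\<forall>C. linked A C \<and> linked B C \<longrightarrow> C \<in> {{}, UNIV, A, B})"
      using A by (auto simp: linked_iff)
  next
    assume *: "A \<noteq> B \<and> linked A B \<and> (\<forall>C. linked A C \<and> linked B C \<longrightarrow> C \<in> {{}, UNIV, A, B})"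
    then have "\<not> A \<subset> B" "\<not> B \<subset> A" using chain[of A B] chain[of B A] A B by blast+
    then show "B = - A" using * by (auto simp: linked_iff)
  qed
qed

context topology_preserving
begin

lemma linked_F: "linked (F A) (F B) \<longleftrightarrow> linked A B"
  using topologies_iff[of "{{}, UNIV, A, B}"] by (simp add: linked_def F_empty F_UNIV)

lemma complement_F:
  assumes "A \<noteq> {}" "A \<noteq> UNIV"
  shows "F B = - F A \<longleftrightarrow> B = - A"
proof (cases "B = {} \<or> B = UNIV")
  case True
  then show ?thesis using assms F_proper[of A] F_empty F_UNIV by auto
next
  case False
  have "(\<forall>C. linked (F A) C \<and> linked (F B) C \<longrightarrow> C \<in> {{}, UNIV, F A, F B}) \<longleftrightarrow>
        (\<forall>C. linked (F A) (F C) \<and> linked (F B) (F C) \<longrightarrow> F C \<in> {{}, UNIV, F A, F B})"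
    by (metis F_surj)
  also have "\<dots> \<longleftrightarrow> (\<forall>C. linked A C \<and> linked B C \<longrightarrow> C \<in> {{}, UNIV, A, B})"
    by (simp add: linked_F F_eq F_proper)
  finally show ?thesis
    using complement_iff_linked[OF large_cod, of "F A" "F B"]
      complement_iff_linked[OF large_dom, of A B] assms False
    by (simp add: F_proper F_eq linked_F)
qed

lemma comparable_F: "F A \<subseteq> F B \<or> F B \<subseteq> F A \<longleftrightarrow> A \<subseteq> B \<or> B \<subseteq> A"
proof (cases "A = {} \<or> A = UNIV \<or> B = {} \<or> B = UNIV")
  case True
  then show ?thesis using F_empty F_UNIV by auto
next
  case False
  then have "linked A B \<and> B \<noteq> - A \<longleftrightarrow> A \<subseteq> B \<or> B \<subseteq> A"
    by (auto simp: linked_iff)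
  moreover have "linked (F A) (F B) \<and> F B \<noteq> - F A \<longleftrightarrow> F A \<subseteq> F B \<or> F B \<subseteq> F A"
    using False F_proper[of A] F_proper[of B] by (auto simp: linked_iff)
  ultimately show ?thesis using False complement_F linked_F by metis
qed

text \<open>The preimage of the topology generated by \<open>F A\<close> and \<open>F B\<close> is a topology that contains \<open>A\<close> and
  \<open>B\<close>, hence also \<open>A \<inter> B\<close> and \<open>A \<union> B\<close>. This is the source of all information on the orientation
  of \<open>F\<close>.\<close>

lemma F_Int_Un:
  assumes "\<not> A \<subseteq> B" "\<not> B \<subseteq> A"
  shows "A \<inter> B \<noteq> {} \<Longrightarrow> F (A \<inter> B) \<in> {F A \<inter> F B, F A \<union> F B}"
    and "A \<union> B \<noteq> UNIV \<Longrightarrow> F (A \<union> B) \<in> {F A \<inter> F B, F A \<union> F B}"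
proof -
  define T where "T = inv F ` pair_top (F A) (F B)"
  have FT: "F ` T = pair_top (F A) (F B)"
    using bij by (simp add: T_def image_f_inv_f bij_is_surj)
  then have T: "T \<in> topologies" using topologies_iff pair_top_topologies by metis
  have "A \<in> T" "B \<in> T"
    using bij by (auto simp: T_def pair_top_def bij_is_inj)
  then have "A \<inter> B \<in> T" "A \<union> B \<in> T" using T topologies_Int topologies_Un by blast+
  then have mem: "F (A \<inter> B) \<in> pair_top (F A) (F B)" "F (A \<union> B) \<in> pair_top (F A) (F B)"
    using FT by blast+
  show "F (A \<inter> B) \<in> {F A \<inter> F B, F A \<union> F B}" if "A \<inter> B \<noteq> {}"
    using mem(1) assms that unfolding pair_top_def insert_iff F_proper F_eq by auto
  show "F (A \<union> B) \<in> {F A \<inter> F B, F A \<union> F B}" if "A \<union> B \<noteq> UNIV"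
    using mem(2) assms that unfolding pair_top_def insert_iff F_proper F_eq by auto
qed

text \<open>The relative complement \<open>D\<close> of \<open>B\<close> in the interval from \<open>A\<close> to \<open>C\<close> is incomparable to \<open>B\<close>. As
  \<open>A\<close> and \<open>C\<close> are the meet and the join of \<open>B\<close> and \<open>D\<close>, their images are those of \<open>F B\<close> and \<open>F D\<close> in
  one of the two orders, and \<open>F B\<close> lies between them.\<close>

lemma F_chain:
  assumes "A \<noteq> {}" "A \<subset> B" "B \<subset> C" "C \<noteq> UNIV"
  shows "F A \<subseteq> F B \<and> F B \<subseteq> F C \<or> F C \<subseteq> F B \<and> F B \<subseteq> F A"
proof -
  define D where "D = A \<union> (C - B)"
  have D: "\<not> B \<subseteq> D" "\<not> D \<subseteq> B" "B \<inter> D = A" "B \<union> D = C" using assms by (auto simp: D_def)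
  have "F A \<in> {F B \<inter> F D, F B \<union> F D}" "F C \<in> {F B \<inter> F D, F B \<union> F D}"
    using F_Int_Un[OF D(1,2)] D(3,4) assms by auto
  moreover have "F A \<noteq> F C" using assms F_eq by auto
  ultimately show ?thesis by auto
qed

text \<open>Inclusions with a common smaller set are treated alike by \<open>F\<close>. Nested larger sets form a chain;
  otherwise \<open>B \<inter> B'\<close> either is \<open>A\<close>, where the generated topology decides, or forms a chain
  with each of \<open>B\<close> and \<open>B'\<close>.\<close>

lemma F_up:
  assumes "A \<noteq> {}" "A \<subset> B" "A \<subset> B'" "B \<noteq> UNIV" "B' \<noteq> UNIV"
  shows "F A \<subseteq> F B \<longleftrightarrow> F A \<subseteq> F B'"
proof -
  have strict: "\<not> (F A \<subseteq> F C \<and> F C \<subseteq> F A)" if "A \<subset> C" for C using that F_eq by auto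
  have nested: "F A \<subseteq> F P \<longleftrightarrow> F A \<subseteq> F Q" if "A \<subset> P" "P \<subseteq> Q" "Q \<noteq> UNIV" for P Q
  proof (cases "P = Q")
    case False
    then show ?thesis
      using F_chain[of A P Q] strict[of P] strict[of Q] that assms(1) by auto
  qed simp
  show ?thesis
  proof (cases "B \<subseteq> B' \<or> B' \<subseteq> B")
    case True
    then show ?thesis using nested assms by metis
  next
    case False
    show ?thesis
    proof (cases "B \<inter> B' = A")
      case True
      then have "F A \<in> {F B \<inter> F B', F B \<union> F B'}"
        using F_Int_Un(1)[of B B'] False assms(1) by auto
      then show ?thesis using strict[of B] strict[of B'] assms by auto
    next
      case neq: False
      then have "A \<subset> B \<inter> B'" using assms by auto
      then show ?thesis using nested[of "B \<inter> B'"] assms by (metis Int_lower1 Int_lower2)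
    qed
  qed
qed

text \<open>The order dual: inclusions with a common larger set are treated alike.\<close>

lemma F_down:
  assumes "B \<noteq> {}" "B' \<noteq> {}" "B \<subset> A" "B' \<subset> A" "A \<noteq> UNIV"
  shows "F B \<subseteq> F A \<longleftrightarrow> F B' \<subseteq> F A"
proof -
  have strict: "\<not> (F A \<subseteq> F C \<and> F C \<subseteq> F A)" if "C \<subset> A" for C using that F_eq by auto
  have nested: "F P \<subseteq> F A \<longleftrightarrow> F Q \<subseteq> F A" if "Q \<subset> A" "P \<subseteq> Q" "P \<noteq> {}" for P Q
  proof (cases "P = Q")
    case False
    then show ?thesis
      using F_chain[of P Q A] strict[of P] strict[of Q] that assms(5) by auto
  qed simp
  show ?thesis
  proof (cases "B \<subseteq> B' \<or> B' \<subseteq> B")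
    case True
    then show ?thesis using nested assms by metis
  next
    case False
    show ?thesis
    proof (cases "B \<union> B' = A")
      case True
      then have "F A \<in> {F B \<inter> F B', F B \<union> F B'}"
        using F_Int_Un(2)[of B B'] False assms(5) by auto
      then show ?thesis using strict[of B] strict[of B'] assms by auto
    next
      case neq: False
      then have "B \<union> B' \<subset> A" using assms by auto
      then show ?thesis using nested[of "B \<union> B'"] assms by (metis Un_upper1 Un_upper2)
    qed
  qed
qed

text \<open>The orientation of \<open>A \<subset> B\<close> is that of \<open>{x} \<subset> B\<close> for \<open>x \<in> A\<close>, and any two points are
  connected through the pair that they form: \<open>{x} \<subset> {x, y} \<supset> {y}\<close>.\<close>

lemma orientation_constant:
  assumes "A \<noteq> {}" "A \<subset> B" "B \<noteq> UNIV" "A' \<noteq> {}" "A' \<subset> B'" "B' \<noteq> UNIV"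
  shows "F A \<subseteq> F B \<longleftrightarrow> F A' \<subseteq> F B'"
proof -
  have single: "\<exists>x. {x} \<subset> B \<and> (F A \<subseteq> F B \<longleftrightarrow> F {x} \<subseteq> F B)"
    if AB: "A \<noteq> {}" "A \<subset> B" "B \<noteq> UNIV" for A B
  proof -
    obtain x where x: "x \<in> A" using AB by blast
    then have "{x} \<subset> B" using AB by auto
    then show ?thesis using F_down[of A "{x}" B] AB by blast
  qed
  obtain x where x: "{x} \<subset> B" "F A \<subseteq> F B \<longleftrightarrow> F {x} \<subseteq> F B" using single assms by metis
  obtain y where y: "{y} \<subset> B'" "F A' \<subseteq> F B' \<longleftrightarrow> F {y} \<subseteq> F B'" using single assms by metis
  show ?thesis
  proof (cases "x = y")
    case True
    then show ?thesis using F_up[of "{x}" B B'] x y assms by auto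
  next
    case False
    have pair: "{x, y} \<noteq> UNIV" using large_dom[of x y y] by auto
    have "F {x} \<subseteq> F B \<longleftrightarrow> F {x} \<subseteq> F {x, y}"
      using F_up[of "{x}" B "{x, y}"] False pair x assms by auto
    also have "\<dots> \<longleftrightarrow> F {y} \<subseteq> F {x, y}"
      using F_down[of "{x}" "{y}" "{x, y}"] False pair by auto
    also have "\<dots> \<longleftrightarrow> F {y} \<subseteq> F B'"
      using F_up[of "{y}" "{x, y}" B'] False pair y assms by auto
    finally show ?thesis using x y by simp
  qed
qed

end

lemma power_set_order_iso_is_image:
  fixes G :: "'x set \<Rightarrow> 'y set"
  assumes surj: "surj G" and ord: "\<And>A B. G A \<subseteq> G B \<longleftrightarrow> A \<subseteq> B"
  obtains f :: "'x \<Rightarrow> 'y" where "bij f" "\<And>A. G A = f ` A"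
proof -
  have eq: "G A = G B \<longleftrightarrow> A = B" for A B using ord by (metis order_antisym order_refl)
  have empty: "G {} = {}" using surj ord by (metis empty_subsetI surjD subset_empty)
  have single: "\<exists>y. G {x} = {y}" for x
  proof -
    obtain y where y: "y \<in> G {x}" using eq[of "{x}" "{}"] empty by auto
    obtain A where A: "{y} = G A" using surj by (metis surjD)
    have "G A \<subseteq> G {x}" using y by (simp flip: A)
    then have "A \<subseteq> {x}" by (simp only: ord)
    moreover have "A \<noteq> {}" using A empty by auto
    ultimately show ?thesis using A by (metis subset_singletonD)
  qed
  then obtain f where f: "\<And>x. G {x} = {f x}" by metis
  have onto: "\<exists>x. y = f x" for y
  proof -
    obtain B where B: "{y} = G B" using surj by (metis surjD)
    then have "B \<noteq> {}" using empty by (metis insert_not_empty)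
    then obtain x where "x \<in> B" by blast
    then have "G {x} \<subseteq> {y}" using B ord by auto
    then show ?thesis using f by auto
  qed
  have mem: "f x \<in> G A \<longleftrightarrow> x \<in> A" for x A using ord[of "{x}" A] f by auto
  have "inj f" using f eq by (metis injI singleton_inject)
  moreover have "surj f" using onto by (auto simp: surj_def)
  moreover have "G A = f ` A" for A using mem onto by (auto simp: image_iff) metis
  ultimately show thesis using that by (simp add: bij_def)
qed

context topology_preserving
begin

text \<open>An order-reversing \<open>F\<close> becomes an isomorphism of power sets after complementation, except that
  \<open>{}\<close> and \<open>UNIV\<close> are fixed by \<open>F\<close> in either case and must not be complemented.\<close>

lemma F_is_image_or_complement:
  obtains f :: "'x \<Rightarrow> 'y" where "bij f"
    "(\<forall>A. F A = f ` A) \<or> (\<forall>A. A \<noteq> {} \<and> A \<noteq> UNIV \<longrightarrow> F A = - f ` A)"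
proof (cases "\<forall>A B. A \<noteq> {} \<and> A \<subset> B \<and> B \<noteq> UNIV \<longrightarrow> F A \<subseteq> F B")
  case True
  have mono: "F A \<subseteq> F B" if "A \<subseteq> B" for A B
    using True that F_empty F_UNIV by (cases "A = {} \<or> A = B \<or> B = UNIV") auto
  have "F A \<subseteq> F B \<longleftrightarrow> A \<subseteq> B" for A B
    using mono comparable_F F_eq by (metis order_antisym)
  then obtain f where "bij f" "\<And>A. F A = f ` A"
    using power_set_order_iso_is_image bij bij_is_surj by metis
  then show thesis using that by blast
next
  case False
  then have no: "\<not> F A \<subseteq> F B" if "A \<noteq> {}" "A \<subset> B" "B \<noteq> UNIV" for A B
    using orientation_constant that by metis
  have anti: "F B \<subseteq> F A" if "A \<noteq> {}" "A \<subseteq> B" "B \<noteq> UNIV" for A B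
    using no[of A B] that comparable_F[of A B] by (cases "A = B") auto
  define G where "G A = (if A = {} \<or> A = UNIV then F A else - F A)" for A
  have "G A \<subseteq> G B \<longleftrightarrow> A \<subseteq> B" for A B
  proof (cases "A = {} \<or> A = UNIV \<or> B = {} \<or> B = UNIV")
    case True
    then show ?thesis
      using F_empty F_UNIV F_proper[of A] F_proper[of B] by (auto simp: G_def)
  next
    case False
    then have "F B \<subseteq> F A \<longleftrightarrow> A \<subseteq> B" using anti comparable_F F_eq by (metis order_antisym)
    then show ?thesis using False by (auto simp: G_def)
  qed
  moreover have "\<exists>A. B = G A" for B
  proof (cases "B = {} \<or> B = UNIV")
    case True
    then show ?thesis using F_empty F_UNIV unfolding G_def by metis
  next
    case False
    obtain A where A: "- B = F A" by (rule F_surj)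
    then have "A \<noteq> {}" "A \<noteq> UNIV" using False F_empty F_UNIV by auto
    then have "B = G A" using A by (simp add: G_def flip: A)
    then show ?thesis by blast
  qed
  ultimately obtain f where f: "bij f" "\<And>A. G A = f ` A"
    using power_set_order_iso_is_image by (metis surj_def)
  have "\<forall>A. A \<noteq> {} \<and> A \<noteq> UNIV \<longrightarrow> F A = - f ` A"
    by (metis f(2) G_def double_complement)
  then show thesis using that f(1) by blast
qed

end

section \<open>Lattice isomorphisms are induced by bijections\<close>

lemma pushforward_bij:
  assumes "bij f"
  shows "pushforward f T = (`) f ` T"
proof (intro set_eqI iffI)
  fix V assume "V \<in> pushforward f T"
  moreover have "V = f ` (f -` V)" using assms by (simp add: bij_is_surj surj_image_vimage_eq)
  ultimately show "V \<in> (`) f ` T" unfolding pushforward_def by blast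
next
  fix V assume "V \<in> (`) f ` T"
  then show "V \<in> pushforward f T"
    using assms by (auto simp: pushforward_def bij_is_inj inj_vimage_image_eq)
qed

lemma cofinite_topologies: "{U :: 'x set. U = {} \<or> finite (- U)} \<in> topologies"
proof -
  have "\<Union>\<K> = {} \<or> finite (- \<Union>\<K>)" if "\<forall>K\<in>\<K>. K = {} \<or> finite (- K)" for \<K> :: "'x set set"
  proof (cases "\<Union>\<K> = {}")
    case False
    then obtain K where "K \<in> \<K>" "K \<noteq> {}" by blast
    then show ?thesis using that by (metis Compl_anti_mono Union_upper finite_subset)
  qed simp
  then show ?thesis unfolding topologies_def istopology_def by (auto simp: Compl_Int)
qed

text \<open>The cofinite topology rules out complements on an infinite space: the images of singletons would
  be open, hence so would be the image of the complement of a point \<open>p\<close>, which makes \<open>{p}\<close> itself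
  cofinite.\<close>

theorem topologies_lattice_iso_cases:
  fixes \<Phi> :: "'x set set \<Rightarrow> 'y set set"
  assumes iso: "topologies_lattice_iso \<Phi>"
    and large: "\<And>a b c. (UNIV :: 'x set) \<noteq> {a, b, c}"
  obtains f :: "'x \<Rightarrow> 'y" where "bij f"
    "(\<forall>T\<in>topologies. \<Phi> T = pushforward f T) \<or>
     finite (UNIV :: 'x set) \<and> (\<forall>T\<in>topologies. \<Phi> T = complement_top (pushforward f T))"
proof -
  obtain F :: "'x set \<Rightarrow> 'y set" where F: "bij F" "F {} = {}" "F UNIV = UNIV"
    "\<And>T. T \<in> topologies \<Longrightarrow> \<Phi> T = F ` T" "\<And>T. F ` T \<in> topologies \<longleftrightarrow> T \<in> topologies"
    using lattice_iso_acts_on_open_sets[OF iso] by metis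
  \<comment> \<open>The two types have equally many subsets, so the target also has more than three points.\<close>
  have large': "(UNIV :: 'y set) \<noteq> {a, b, c}" for a b c
  proof
    assume U: "(UNIV :: 'y set) = {a, b, c}"
    then have fin: "finite (UNIV :: 'y set)" by (metis finite.emptyI finite_insert)
    have "card (UNIV :: 'y set) \<le> 3"
      unfolding U by (simp add: card_insert_if)
    then have "card (UNIV :: 'y set set) \<le> 2 ^ 3"
      using card_Pow[OF fin] by (simp add: power_increasing del: power_numeral)
    moreover have same: "card (UNIV :: 'x set set) = card (UNIV :: 'y set set)"
      using F(1) by (rule bij_betw_same_card)
    moreover have "finite (UNIV :: 'x set set)"
      using bij_betw_finite[OF F(1)] fin by (metis Finite_Set.finite_set)
    then have fin': "finite (UNIV :: 'x set)" by (simp add: Finite_Set.finite_set)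
    ultimately have "(2::nat) ^ card (UNIV :: 'x set) \<le> 2 ^ 3"
      using card_Pow[OF fin'] by simp
    then have "card (UNIV :: 'x set) \<le> 3" by (rule power_le_imp_le_exp[rotated]) simp
    moreover have "card (UNIV :: 'x set) \<noteq> 0" using fin' by simp
    ultimately have "card (UNIV :: 'x set) \<in> {1, 2, 3}" by auto
    then show False
      using large by (auto simp: card_1_singleton_iff card_2_iff card_3_iff)
  qed
  interpret topology_preserving F
    using F large large' by unfold_locales auto
  obtain f where f: "bij f"
    "(\<forall>A. F A = f ` A) \<or> (\<forall>A. A \<noteq> {} \<and> A \<noteq> UNIV \<longrightarrow> F A = - f ` A)"
    using F_is_image_or_complement by metis
  from f(2) show thesis
  proof
    assume "\<forall>A. F A = f ` A"
    then have "\<Phi> T = pushforward f T" if "T \<in> topologies" for T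
      using F(4)[OF that] pushforward_bij[OF f(1)] by auto
    then show thesis using that f(1) by blast
  next
    assume anti: "\<forall>A. A \<noteq> {} \<and> A \<noteq> UNIV \<longrightarrow> F A = - f ` A"
    \<comment> \<open>The families at issue contain both \<open>{}\<close> and \<open>UNIV\<close>; swapping these two sets turns the formula
      for \<open>F\<close> into one without exceptions.\<close>
    define \<sigma> where "\<sigma> A = (if A = {} then UNIV else if A = UNIV then {} else A)" for A :: "'x set"
    have F_\<sigma>: "F A = - f ` \<sigma> A" for A
      using anti F(2,3) f(1) by (cases "A = {}"; cases "A = UNIV") (simp_all add: \<sigma>_def bij_is_surj)
    have compl: "\<Phi> T = complement_top (pushforward f T)" if T: "T \<in> topologies" for T
    proof -
      have \<sigma>_T: "\<sigma> A \<in> T" if "A \<in> T" for A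
        using that topologies_empty[OF T] topologies_UNIV[OF T] by (simp add: \<sigma>_def)
      have \<sigma>_\<sigma>: "\<sigma> (\<sigma> A) = A" for A by (simp add: \<sigma>_def)
      have "\<sigma> ` T = T"
      proof
        show "\<sigma> ` T \<subseteq> T" using \<sigma>_T by (rule image_subsetI)
        show "T \<subseteq> \<sigma> ` T"
        proof
          fix A assume "A \<in> T"
          then have "\<sigma> (\<sigma> A) \<in> \<sigma> ` T" by (intro imageI \<sigma>_T)
          then show "A \<in> \<sigma> ` T" by (simp only: \<sigma>_\<sigma>)
        qed
      qed
      moreover have "F ` T = (\<lambda>A. - f ` A) ` \<sigma> ` T"
        unfolding image_image F_\<sigma> ..
      ultimately have "F ` T = (\<lambda>A. - f ` A) ` T" by simp
      then show ?thesis
        using F(4)[OF T] by (auto simp: complement_top_def pushforward_bij[OF f(1)] Compl_eq_Diff_UNIV)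
    qed
    have "finite (UNIV :: 'x set)"
    proof (rule ccontr)
      assume inf: "infinite (UNIV :: 'x set)"
      define T where "T = {U :: 'x set. U = {} \<or> finite (- U)}"
      have T: "T \<in> topologies" unfolding T_def by (rule cofinite_topologies)
      have "F ` T \<in> topologies" using F(5) T by blast
      fix p :: 'x
      have co: "F (- A) = f ` A" if "A \<noteq> {}" "A \<noteq> UNIV" for A
        using anti that f(1) by (metis Compl_UNIV_eq Compl_empty_eq bij_image_Compl_eq double_complement)
      have "f ` {x} \<in> F ` T" for x
      proof -
        have "{x} \<noteq> UNIV" using inf by (metis finite.emptyI finite_insert)
        then have "f ` {x} = F (- {x})" using co by auto
        then show ?thesis by (auto simp: T_def)
      qed
      then have "\<Union> ((\<lambda>x. f ` {x}) ` (- {p})) \<in> F ` T"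
        using topologies_Union[OF \<open>F ` T \<in> topologies\<close>] by (metis image_subsetI)
      moreover have "\<Union> ((\<lambda>x. f ` {x}) ` (- {p})) = f ` (- {p})" by auto
      moreover have "- {p} \<noteq> {}" "- {p} \<noteq> UNIV" using inf
        by (metis Compl_empty_eq double_complement finite.emptyI finite_insert) auto
      ultimately have "F {p} \<in> F ` T" using co[of "- {p}"] by simp
      then have "{p} \<in> T" using F(1) by (metis bij_is_inj inj_image_mem_iff)
      then have "finite (- {p})" by (simp add: T_def)
      then show False using inf by simp
    qed
    then show thesis using that f(1) compl by blast
  qed
qed

section \<open>Vector topologies\<close>

text \<open>The preorder whose upper sets \<open>{y. specializes T x y}\<close> are the intersections of the open
  neighbourhoods of the points \<open>x\<close>. In a vector topology they are the cosets of a subspace; the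
  following lemmas provide the parts of this that are needed.\<close>

definition specializes :: "'x set set \<Rightarrow> 'x \<Rightarrow> 'x \<Rightarrow> bool" where
  "specializes T x y \<longleftrightarrow> (\<forall>U\<in>T. x \<in> U \<longrightarrow> y \<in> U)"

lemma specializesD: "specializes T x y \<Longrightarrow> U \<in> T \<Longrightarrow> x \<in> U \<Longrightarrow> y \<in> U"
  unfolding specializes_def by (rule mp, erule (1) bspec)

lemma openin_top_space: "T \<in> topologies \<Longrightarrow> openin (top_space T) U \<longleftrightarrow> U \<in> T"
  by (simp add: topologies_def)

lemma topspace_top_space: "T \<in> topologies \<Longrightarrow> topspace (top_space T) = UNIV"
  using openin_top_space[of T UNIV] topologies_UNIV[of T] openin_subset by blast

lemma vector_topologies_topologies: "T \<in> vector_topologies scl \<Longrightarrow> T \<in> topologies"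
  by (simp add: vector_topologies_def)

lemma continuous_map_vimage:
  assumes "continuous_map A (top_space T) f" "T \<in> topologies" "topspace A = UNIV" "U \<in> T"
  shows "openin A (f -` U)"
  using openin_continuous_map_preimage[OF assms(1), of U] assms
  by (simp add: openin_top_space vimage_def)

lemma
  assumes T: "T \<in> vector_topologies scl" and U: "U \<in> T"
  shows vector_topology_translate: "(\<lambda>y. x + y) -` U \<in> T"
    and vector_topology_scale: "(\<lambda>y. scl a y) -` U \<in> T"
    and vector_topology_scalars: "open ((\<lambda>a. scl a x) -` U)"
proof -
  let ?T = "top_space T"
  have top: "T \<in> topologies" using T by (rule vector_topologies_topologies)
  have add: "continuous_map (prod_topology ?T ?T) ?T (\<lambda>(x, y). x + y)"
    and scale: "continuous_map (prod_topology euclidean ?T) ?T (\<lambda>(a, x). scl a x)"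
    using T by (auto simp: vector_topologies_def)
  have "continuous_map ?T (prod_topology ?T ?T) (\<lambda>y. (x, y))"
    by (intro continuous_map_pairedI)
      (simp_all add: continuous_map_id[unfolded id_def] topspace_top_space[OF top])
  from continuous_map_compose[OF this add]
  have "continuous_map ?T ?T (\<lambda>y. x + y)" by (simp add: o_def)
  from continuous_map_vimage[OF this top topspace_top_space[OF top] U]
  show "(\<lambda>y. x + y) -` U \<in> T" by (simp add: openin_top_space[OF top])
  have "continuous_map ?T (prod_topology euclidean ?T) (\<lambda>y. (a, y))"
    by (intro continuous_map_pairedI) (simp_all add: continuous_map_id[unfolded id_def])
  from continuous_map_compose[OF this scale]
  have "continuous_map ?T ?T (\<lambda>y. scl a y)" by (simp add: o_def)
  from continuous_map_vimage[OF this top topspace_top_space[OF top] U]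
  show "(\<lambda>y. scl a y) -` U \<in> T" by (simp add: openin_top_space[OF top])
  have "continuous_map euclidean (prod_topology euclidean ?T) (\<lambda>a. (a, x))"
    by (intro continuous_map_pairedI)
      (simp_all add: continuous_map_id[unfolded id_def] topspace_top_space[OF top])
  from continuous_map_compose[OF this scale]
  have "continuous_map euclidean ?T (\<lambda>a. scl a x)" by (simp add: o_def)
  from continuous_map_vimage[OF this top _ U]
  show "open ((\<lambda>a. scl a x) -` U)" by simp
qed

lemma specializes_translate:
  assumes T: "T \<in> vector_topologies scl" and xy: "specializes T x y"
  shows "specializes T (z + x) (z + y)"
  unfolding specializes_def
proof (intro ballI impI)
  fix U assume U: "U \<in> T" "z + x \<in> U"
  then have "x \<in> (\<lambda>y. z + y) -` U" by simp
  then have "y \<in> (\<lambda>y. z + y) -` U"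
    by (rule specializesD[OF xy vector_topology_translate[OF T U(1)]])
  then show "z + y \<in> U" by simp
qed

lemma specializes_scale:
  assumes V: "vector_space scl" and T: "T \<in> vector_topologies scl" and y: "specializes T 0 y"
  shows "specializes T 0 (scl a y)"
  unfolding specializes_def
proof (intro ballI impI)
  interpret vector_space scl by (rule V)
  fix U assume U: "U \<in> T" "0 \<in> U"
  have "0 \<in> scl a -` U" using U by simp
  then have "y \<in> scl a -` U"
    by (rule specializesD[OF y vector_topology_scale[OF T U(1)]])
  then show "scl a y \<in> U" by simp
qed

text \<open>Translate \<open>x\<close> to the origin, multiply by \<open>-1\<close> and translate to \<open>y\<close>.\<close>

lemma specializes_sym:
  assumes V: "vector_space scl" and T: "T \<in> vector_topologies scl" and xy: "specializes T x y"
  shows "specializes T y x"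
proof -
  interpret vector_space scl by (rule V)
  have "specializes T 0 (y - x)" using specializes_translate[OF T xy, of "- x"] by simp
  from specializes_scale[OF V T this, of "- 1"]
  have "specializes T 0 (x - y)" by simp
  from specializes_translate[OF T this, of y] show ?thesis by simp
qed

text \<open>In a finite space each point \<open>x\<close> has a least open neighbourhood \<open>N x\<close>. By symmetry of the
  specialization preorder \<open>N x\<close> is disjoint from every open set that does not contain \<open>x\<close>.\<close>

lemma complement_vector_topology_finite:
  fixes scl :: "'k::topological_field \<Rightarrow> 'x::ab_group_add \<Rightarrow> 'x"
  assumes V: "vector_space scl" and fin: "finite (UNIV :: 'x set)"
    and T: "T \<in> vector_topologies scl"
  shows "complement_top T = T"
proof -
  have top: "T \<in> topologies" using T by (rule vector_topologies_topologies)
  have compl: "- U \<in> T" if U: "U \<in> T" for U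
  proof -
    define N where "N x = \<Inter> {W \<in> T. x \<in> W}" for x
    have "\<Inter> \<W> \<in> T" if "finite \<W>" "\<W> \<subseteq> T" for \<W>
      using that by induction (auto simp: topologies_UNIV[OF top] topologies_Int[OF top])
    moreover have "finite {W \<in> T. x \<in> W}" for x
      using fin by (metis Finite_Set.finite_set finite_subset top_greatest)
    ultimately have N: "N x \<in> T" for x by (simp add: N_def)
    have N_iff: "y \<in> N x \<longleftrightarrow> specializes T x y" for x y by (auto simp: N_def specializes_def)
    have "\<Union> (N ` (- U)) \<in> T" using N by (intro topologies_Union[OF top]) auto
    moreover have "\<Union> (N ` (- U)) = - U"
    proof (intro set_eqI iffI)
      fix y assume "y \<in> \<Union> (N ` (- U))"
      then obtain x where x: "x \<notin> U" "specializes T x y" by (auto simp: N_iff)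
      show "y \<in> - U"
        using specializesD[OF specializes_sym[OF V T x(2)] U] x(1) by blast
    next
      fix y assume "y \<in> - U"
      moreover have "y \<in> N y" by (simp add: N_def)
      ultimately show "y \<in> \<Union> (N ` (- U))" by blast
    qed
    ultimately show ?thesis by simp
  qed
  show ?thesis
  proof (intro set_eqI iffI)
    fix V assume "V \<in> complement_top T"
    then show "V \<in> T" using compl by (auto simp: complement_top_def simp flip: Compl_eq_Diff_UNIV)
  next
    fix V assume "V \<in> T"
    then have "- V \<in> T" "V = UNIV - (- V)" using compl by auto
    then show "V \<in> complement_top T" unfolding complement_top_def by blast
  qed
qed

text \<open>The initial topology of \<open>h\<close>. Unlike the discrete topology, which is a vector topology over a
  discrete field only, it is available over every topological field, and it remembers both the
  kernel of \<open>h\<close> and the topology of the field.\<close>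

definition functional_top :: "('x \<Rightarrow> 'k::topological_space) \<Rightarrow> 'x set set" where
  "functional_top h = {h -` U | U. open U}"

lemma top_space_functional_top: "top_space (functional_top h) = pullback_topology UNIV h euclidean"
proof -
  have "(\<lambda>U. U \<in> functional_top h) = openin (pullback_topology UNIV h euclidean)"
    by (auto simp: functional_top_def openin_pullback_topology fun_eq_iff)
  then show ?thesis by (simp add: openin_inverse)
qed

lemma functional_top_vector_topology:
  fixes scl :: "'k::topological_field \<Rightarrow> 'x::ab_group_add \<Rightarrow> 'x"
  assumes h: "Vector_Spaces.linear scl (*) h"
  shows "functional_top h \<in> vector_topologies scl"
proof -
  interpret h: Vector_Spaces.linear scl "(*)" h by (rule h)
  let ?T = "pullback_topology UNIV h (euclidean :: 'k topology)"
  have "(\<lambda>U. U \<in> functional_top h) = openin ?T"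
    by (auto simp: functional_top_def openin_pullback_topology fun_eq_iff)
  moreover have "UNIV \<in> functional_top h"
    unfolding functional_top_def using open_UNIV by blast
  ultimately have "functional_top h \<in> topologies"
    by (simp add: topologies_def)
  have cont_h: "continuous_map ?T euclidean h"
    using continuous_map_pullback[OF continuous_map_id, of UNIV h euclidean] by simp
  have "continuous_map (prod_topology ?T ?T) (prod_topology euclidean euclidean)
      (\<lambda>(x, y). (h x, h y))"
    using cont_h by (intro continuous_map_prod_top[THEN iffD2]) auto
  moreover have "continuous_map (prod_topology euclidean euclidean) euclidean (\<lambda>(x, y). x + y :: 'k)"
    using topological_field_continuous(1)
    by (simp flip: euclidean_product_topology add: continuous_map_iff_continuous2)
  ultimately have "continuous_map (prod_topology ?T ?T) euclidean
      ((\<lambda>(x, y). x + y) \<circ> (\<lambda>(x, y). (h x, h y)))"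
    by (rule continuous_map_compose)
  moreover have "(\<lambda>(x, y). x + y) \<circ> (\<lambda>(x, y). (h x, h y)) = h \<circ> (\<lambda>(x, y). x + y)"
    by (auto simp: h.add)
  ultimately have add: "continuous_map (prod_topology ?T ?T) ?T (\<lambda>(x, y). x + y)"
    by (intro continuous_map_pullback') auto
  have "continuous_map (prod_topology euclidean ?T) (prod_topology euclidean euclidean)
      (\<lambda>(a, x). (id a, h x))"
    using cont_h by (intro continuous_map_prod_top[THEN iffD2]) auto
  moreover have "continuous_map (prod_topology euclidean euclidean) euclidean (\<lambda>(x, y). x * y :: 'k)"
    using topological_field_continuous(2)
    by (simp flip: euclidean_product_topology add: continuous_map_iff_continuous2)
  ultimately have "continuous_map (prod_topology euclidean ?T) euclidean
      ((\<lambda>(x, y). x * y) \<circ> (\<lambda>(a, x). (id a, h x)))"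
    by (rule continuous_map_compose)
  moreover have "(\<lambda>(x, y). x * y) \<circ> (\<lambda>(a, x). (id a, h x)) = h \<circ> (\<lambda>(a, x). scl a x)"
    by (auto simp: h.scale)
  ultimately have scale: "continuous_map (prod_topology euclidean ?T) ?T (\<lambda>(a, x). scl a x)"
    by (intro continuous_map_pullback') auto
  show ?thesis
    using \<open>functional_top h \<in> topologies\<close> add scale
    by (simp add: vector_topologies_def top_space_functional_top)
qed

lemma specializes_functional_top:
  fixes h :: "'x \<Rightarrow> 'k::topological_field"
  shows "specializes (functional_top h) x y \<longleftrightarrow> h x = h y"
proof
  assume *: "specializes (functional_top h) x y"
  show "h x = h y"
  proof (rule ccontr)
    assume "h x \<noteq> h y"
    then have "x \<in> h -` (- {h y})" by simp
    moreover have "h -` (- {h y}) \<in> functional_top h"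
      unfolding functional_top_def using open_Compl[OF closed_singleton] by blast
    ultimately have "y \<in> h -` (- {h y})" by (intro specializesD[OF *])
    then show False by simp
  qed
qed (auto simp: specializes_def functional_top_def)

section \<open>Linear functionals and dimension\<close>

lemma functional_separating:
  fixes scl :: "'k::field \<Rightarrow> 'x::ab_group_add \<Rightarrow> 'x"
  assumes V: "vector_space scl" and z: "\<And>b. z \<noteq> scl b y"
  obtains h where "Vector_Spaces.linear scl (*) h" "h y = 0" "h z = 1"
proof -
  interpret vector_space scl by (rule V)
  interpret vector_space_pair scl "(*) :: 'k \<Rightarrow> 'k \<Rightarrow> 'k" by unfold_locales (auto simp: algebra_simps)
  have "z \<notin> span {y}" using z by (auto simp: span_singleton)
  have zy: "z \<noteq> y" using z[of 1] by simp
  define B where "B = {y} - {0}"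
  have "independent B"
    by (cases "y = 0") (simp_all add: B_def independent_empty)
  moreover have "z \<notin> span B"
    using \<open>z \<notin> span {y}\<close> span_mono[of B "{y}"] by (auto simp: B_def)
  ultimately have "independent (insert z B)" by (intro independent_insertI)
  then obtain h where h: "Vector_Spaces.linear scl (*) h"
    "\<forall>x \<in> insert z B. h x = (if x = z then 1 else 0)"
    using linear_independent_extend[of "insert z B" "\<lambda>x. if x = z then 1 else 0"] by blast
  interpret h: Vector_Spaces.linear scl "(*)" h by (rule h(1))
  have "h y = 0" using h(2) zy by (cases "y = 0") (auto simp: B_def)
  then show thesis using that h by auto
qed

lemma dim_at_least_2D:
  fixes scl :: "'k::field \<Rightarrow> 'x::ab_group_add \<Rightarrow> 'x"
  assumes V: "vector_space scl" and dim: "dim_at_least 2 scl"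
  shows "\<exists>z. \<forall>a. z \<noteq> scl a x"
proof (rule ccontr)
  interpret vector_space scl by (rule V)
  assume "\<not> ?thesis"
  then have "span {x} = UNIV" by (auto simp: span_singleton)
  moreover obtain B where "independent B" "infinite B \<or> 2 \<le> card B"
    using dim by (auto simp: dim_at_least_def)
  ultimately show False using independent_span_bound[of "{x}" B] by auto
qed

lemma dim_at_least_2_large:
  fixes scl :: "'k::field \<Rightarrow> 'x::ab_group_add \<Rightarrow> 'x"
  assumes V: "vector_space scl" and dim: "dim_at_least 2 scl"
  shows "(UNIV :: 'x set) \<noteq> {a, b, c}"
proof
  interpret vector_space scl by (rule V)
  assume U: "(UNIV :: 'x set) = {a, b, c}"
  obtain x :: 'x where x: "x \<noteq> 0" using dim_at_least_2D[OF V dim, of 0] scale_zero_right by metis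
  obtain z where z: "\<And>a. z \<noteq> scl a x" using dim_at_least_2D[OF V dim, of x] by blast
  have "z \<noteq> 0" "z \<noteq> x" "x + z \<noteq> 0" using z[of 0] z[of 1] z[of "- 1"] by (auto simp: add_eq_0_iff)
  then have "card {0, x, z, x + z} = 4" using x by auto
  moreover have "card {0, x, z, x + z} \<le> card {a, b, c}"
    by (rule card_mono) (simp, simp flip: U)
  moreover have "card {a, b, c} \<le> 3" by (simp add: card_insert_if)
  ultimately show False by simp
qed

section \<open>Bijections preserving vector topologies are affine\<close>

lemma specializes_pushforward:
  assumes "bij f"
  shows "specializes (pushforward f S) (f u) (f v) \<longleftrightarrow> specializes S u v"
  by (simp add: specializes_def pushforward_bij[OF assms] inj_image_mem_iff[OF bij_is_inj[OF assms]])

text \<open>Every functional \<open>h\<close> that vanishes on \<open>f y - f p\<close> comes from a vector topology on the source, in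
  which \<open>p\<close> and \<open>y\<close> are therefore indistinguishable. Then so are \<open>x\<close> and \<open>x + a(y - p)\<close>, which says
  that \<open>h\<close> takes the same value on their images. As this holds for all such \<open>h\<close>, the difference of
  the images is a multiple of \<open>f y - f p\<close>.\<close>

lemma lines_into_lines:
  fixes scaleX :: "'k::topological_field \<Rightarrow> 'x::ab_group_add \<Rightarrow> 'x"
    and scaleY :: "'l::topological_field \<Rightarrow> 'y::ab_group_add \<Rightarrow> 'y"
  assumes X: "vector_space scaleX" and Y: "vector_space scaleY" and f: "bij f"
    and sub: "vector_topologies scaleY \<subseteq> pushforward f ` vector_topologies scaleX"
  shows "\<exists>b. f (x + scaleX a (y - p)) = f x + scaleY b (f y - f p)"
proof (rule ccontr)
  assume none: "\<not> ?thesis"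
  have "f (x + scaleX a (y - p)) - f x \<noteq> scaleY b (f y - f p)" for b
  proof
    assume "f (x + scaleX a (y - p)) - f x = scaleY b (f y - f p)"
    then have "f (x + scaleX a (y - p)) = f x + scaleY b (f y - f p)"
      by (simp add: diff_eq_eq add.commute)
    then show False using none by blast
  qed
  then obtain h where h: "Vector_Spaces.linear scaleY (*) h" "h (f y - f p) = 0"
    "h (f (x + scaleX a (y - p)) - f x) = 1"
    using functional_separating[OF Y] by metis
  interpret h: Vector_Spaces.linear scaleY "(*)" h by (rule h(1))
  obtain S where S: "S \<in> vector_topologies scaleX" "functional_top h = pushforward f S"
    using sub functional_top_vector_topology[OF h(1)] by blast
  have spec: "specializes S u v \<longleftrightarrow> h (f u) = h (f v)" for u v
    using specializes_pushforward[OF f, of S u v] specializes_functional_top[of h] S(2) by metis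
  have "specializes S p y" using h(2) by (simp add: spec h.diff)
  from specializes_translate[OF S(1) this, of "- p"]
  have "specializes S 0 (y - p)" by simp
  from specializes_translate[OF S(1) specializes_scale[OF X S(1) this, of a], of x]
  have "h (f x) = h (f (x + scaleX a (y - p)))" by (simp add: spec)
  then show False using h(3) by (simp add: h.diff)
qed

text \<open>The version of the fundamental theorem in which \<open>\<phi>\<close> is known to map the line through \<open>x\<close> in
  direction \<open>y\<close> onto the line through \<open>\<phi> x\<close> in direction \<open>\<phi> y\<close>; this knowledge about parallels makes
  the argument uniform in the field, including the field with two elements. For independent \<open>x\<close> and
  \<open>y\<close> the point \<open>x + y\<close> is the intersection of two such lines, which gives additivity. Dependent
  vectors are treated with the help of a third one outside their line, and comparing
  \<open>\<phi> (a (x + y))\<close> with \<open>\<phi> (a x) + \<phi> (a y)\<close> shows that the multiplier of \<open>a\<close> does not depend on the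
  vector.\<close>

lemma fundamental_theorem_affine_geometry:
  fixes scaleX :: "'k::field \<Rightarrow> 'x::ab_group_add \<Rightarrow> 'x"
    and scaleY :: "'l::field \<Rightarrow> 'y::ab_group_add \<Rightarrow> 'y"
  assumes X: "vector_space scaleX" and Y: "vector_space scaleY" and dim: "dim_at_least 2 scaleX"
    and bij: "bij \<phi>" and zero: "\<phi> 0 = 0"
    and line: "\<And>x y a. \<exists>b. \<phi> (x + scaleX a y) = \<phi> x + scaleY b (\<phi> y)"
    and line': "\<And>x y b. \<exists>a. \<phi> x + scaleY b (\<phi> y) = \<phi> (x + scaleX a y)"
  obtains \<psi> where "bij \<psi>" "\<psi> 1 = 1" "\<And>a b. \<psi> (a + b) = \<psi> a + \<psi> b" "\<And>a b. \<psi> (a * b) = \<psi> a * \<psi> b"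
    "semilinear_iso scaleX scaleY \<psi> \<phi>"
proof -
  interpret X: vector_space scaleX by (rule X)
  interpret Y: vector_space scaleY by (rule Y)
  have eq: "\<phi> x = \<phi> y \<longleftrightarrow> x = y" for x y using bij by (simp add: bij_def inj_eq)
  have eq0: "\<phi> x = 0 \<longleftrightarrow> x = 0" for x using eq[of x 0] zero by simp
  define ind where "ind x y \<longleftrightarrow> x \<noteq> 0 \<and> (\<forall>a. y \<noteq> scaleX a x)" for x y
  have ex_ind: "\<exists>z. ind x z" if "x \<noteq> 0" for x
    using dim_at_least_2D[OF X dim, of x] that by (auto simp: ind_def)
  have ind_sym: "ind y x" if "ind x y" for x y
    unfolding ind_def
  proof (intro conjI allI notI)
    show False if "y = 0" using \<open>ind x y\<close> that by (auto simp: ind_def dest: spec[of _ 0])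
    show False if "x = scaleX a y" for a
    proof -
      have "a \<noteq> 0" using \<open>ind x y\<close> that by (auto simp: ind_def)
      then have "y = scaleX (inverse a) x" using that by simp
      then show False using \<open>ind x y\<close> by (auto simp: ind_def)
    qed
  qed
  have ind_add: "ind x (y + scaleX c x)" if "ind x y" for x y c
    unfolding ind_def
  proof (intro conjI allI notI)
    show False if "x = 0" using \<open>ind x y\<close> that by (auto simp: ind_def)
    show False if "y + scaleX c x = scaleX a x" for a
    proof -
      have "y = scaleX (a - c) x" using that by (simp add: X.scale_left_diff_distrib algebra_simps)
      then show False using \<open>ind x y\<close> by (auto simp: ind_def)
    qed
  qed
  have ind_scale: "ind (scaleX c x) y" if "ind x y" "c \<noteq> 0" for x y c
    using that by (auto simp: ind_def)
  have ind_\<phi>: "\<phi> y \<noteq> scaleY b (\<phi> x)" if "ind x y" for x y b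
  proof
    assume "\<phi> y = scaleY b (\<phi> x)"
    moreover obtain a where "\<phi> 0 + scaleY b (\<phi> x) = \<phi> (0 + scaleX a x)" using line' by blast
    ultimately have "y = scaleX a x" using zero eq by simp
    then show False using that by (auto simp: ind_def)
  qed
  have coords: "b = b' \<and> c = c'"
    if "ind x y" "scaleY b (\<phi> x) + scaleY c (\<phi> y) = scaleY b' (\<phi> x) + scaleY c' (\<phi> y)"
    for x y b c b' c'
  proof -
    have *: "scaleY (c - c') (\<phi> y) = scaleY (b' - b) (\<phi> x)"
      using that(2) by (simp add: Y.scale_left_diff_distrib algebra_simps)
    have "c = c'"
    proof (rule ccontr)
      assume "c \<noteq> c'"
      then have "\<phi> y = scaleY (inverse (c - c')) (scaleY (c - c') (\<phi> y))" by simp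
      also have "\<dots> = scaleY (inverse (c - c') * (b' - b)) (\<phi> x)" unfolding * by simp
      finally show False using ind_\<phi>[OF that(1)] by blast
    qed
    moreover have "\<phi> x \<noteq> 0" using that(1) eq0 by (auto simp: ind_def)
    ultimately show ?thesis using * by simp
  qed
  have add_ind: "\<phi> (x + y) = \<phi> x + \<phi> y" if "ind x y" for x y
  proof -
    obtain b where b: "\<phi> (x + y) = \<phi> x + scaleY b (\<phi> y)" using line[of x 1 y] by auto
    obtain c where c: "\<phi> (y + x) = \<phi> y + scaleY c (\<phi> x)" using line[of y 1 x] by auto
    have "scaleY 1 (\<phi> x) + scaleY b (\<phi> y) = scaleY c (\<phi> x) + scaleY 1 (\<phi> y)"
      using b c by (simp add: add.commute)
    from coords[OF that this] b show ?thesis by simp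
  qed
  have add: "\<phi> (x + y) = \<phi> x + \<phi> y" for x y
  proof (cases "x = 0 \<or> ind x y")
    case True
    then show ?thesis using add_ind zero by auto
  next
    case False
    then obtain c where y: "y = scaleX c x" "x \<noteq> 0" by (auto simp: ind_def)
    obtain z where z: "ind x z" using ex_ind y by blast
    \<comment> \<open>Both bracketings of \<open>x + y + z\<close> are sums of independent vectors.\<close>
    have xyz: "\<phi> (x + (z + y)) = \<phi> x + \<phi> (z + y)" using add_ind ind_add[OF z] y by blast
    have yz: "\<phi> (z + y) = \<phi> z + \<phi> y"
    proof (cases "y = 0")
      case False
      then have "ind z y" using ind_sym ind_scale[OF z, of c] y by auto
      then show ?thesis by (rule add_ind)
    qed (simp add: zero)
    have "\<phi> (z + (x + y)) = \<phi> z + \<phi> (x + y)"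
    proof (cases "x + y = 0")
      case False
      have "x + y = scaleX (1 + c) x" using y by (simp add: X.scale_left_distrib)
      then have "ind z (x + y)" using ind_sym ind_scale[OF z, of "1 + c"] False by auto
      then show ?thesis by (rule add_ind)
    qed (simp add: zero)
    moreover have "z + (x + y) = x + (z + y)" by (simp add: algebra_simps)
    ultimately have "\<phi> z + \<phi> (x + y) = \<phi> z + (\<phi> x + \<phi> y)" using xyz yz by (simp add: algebra_simps)
    then show ?thesis by simp
  qed
  have "\<exists>b. \<phi> (scaleX a x) = scaleY b (\<phi> x)" for a x
    using line[of 0 a x] zero by simp
  then obtain m where m: "\<And>a x. \<phi> (scaleX a x) = scaleY (m a x) (\<phi> x)" by metis
  have m_ind: "m a x = m a y" if "ind x y" for a x y
  proof -
    have "scaleY (m a x) (\<phi> x) + scaleY (m a y) (\<phi> y) = \<phi> (scaleX a (x + y))"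
      by (simp add: X.scale_right_distrib add m)
    also have "\<dots> = scaleY (m a (x + y)) (\<phi> x) + scaleY (m a (x + y)) (\<phi> y)"
      by (simp add: m add Y.scale_right_distrib)
    finally show ?thesis using coords[OF that] by metis
  qed
  have m_eq: "m a x = m a y" if xy: "x \<noteq> 0" "y \<noteq> 0" for a x y
  proof (cases "ind x y")
    case False
    then obtain c where y: "y = scaleX c x" using xy by (auto simp: ind_def)
    obtain z where z: "ind x z" using ex_ind xy by blast
    then have "ind y z" using ind_scale[OF z, of c] y xy by auto
    then show ?thesis using m_ind z by metis
  qed (rule m_ind)
  obtain e :: 'x where e: "e \<noteq> 0" using dim_at_least_2D[OF X dim, of 0] X.scale_zero_right by metis
  define \<psi> where "\<psi> a = m a e" for a
  have \<phi>e: "\<phi> e \<noteq> 0" using e eq0 by simp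
  have scale: "\<phi> (scaleX a x) = scaleY (\<psi> a) (\<phi> x)" for a x
    using m_eq[of x e a] e zero m[of a x] by (cases "x = 0") (auto simp: \<psi>_def)
  have cancel: "scaleY b (\<phi> e) = scaleY c (\<phi> e) \<longleftrightarrow> b = c" for b c using \<phi>e by simp
  have "inj \<psi>"
  proof (rule injI)
    fix a b assume "\<psi> a = \<psi> b"
    then have "\<phi> (scaleX a e) = \<phi> (scaleX b e)" by (simp add: scale)
    then show "a = b" using eq e by simp
  qed
  moreover have "surj \<psi>"
  proof (unfold surj_def, rule allI)
    fix b
    obtain a where "\<phi> 0 + scaleY b (\<phi> e) = \<phi> (0 + scaleX a e)" using line' by blast
    then have "scaleY b (\<phi> e) = scaleY (\<psi> a) (\<phi> e)" by (simp add: zero scale)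
    then show "\<exists>a. b = \<psi> a" using cancel by blast
  qed
  moreover have "\<psi> 1 = 1" using scale[of 1 e] cancel[of "\<psi> 1" 1] by simp
  moreover have "\<psi> (a + b) = \<psi> a + \<psi> b" for a b
  proof -
    have "scaleY (\<psi> (a + b)) (\<phi> e) = scaleY (\<psi> a + \<psi> b) (\<phi> e)"
      using scale[of "a + b" e] by (simp add: X.scale_left_distrib Y.scale_left_distrib add scale)
    then show ?thesis using cancel by blast
  qed
  moreover have "\<psi> (a * b) = \<psi> a * \<psi> b" for a b
  proof -
    have "scaleY (\<psi> (a * b)) (\<phi> e) = \<phi> (scaleX a (scaleX b e))" by (simp add: scale)
    also have "\<dots> = scaleY (\<psi> a * \<psi> b) (\<phi> e)" by (simp add: scale del: X.scale_scale)
    finally show ?thesis using cancel by blast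
  qed
  moreover have "semilinear_iso scaleX scaleY \<psi> \<phi>"
    using bij add scale by (simp add: semilinear_iso_def)
  ultimately show thesis using that by (simp add: bij_def)
qed

text \<open>Choose \<open>h\<close> with \<open>h e = 1\<close>. Then \<open>h -` Ou\<close> meets the line through \<open>e\<close> in the multiples \<open>a e\<close>
  with \<open>a \<in> Ou\<close>, and \<open>f\<close> carries this set to an open set of a vector topology that meets the
  line \<open>y0 + b v\<close> exactly in the parameters \<open>b \<in> \<psi> ` Ou\<close>. The assumption on \<open>f\<close> concerns
  a single line, so that the lemma applies to the inverse of an affine map as well.\<close>

lemma semilinear_open_map:
  fixes scaleX :: "'k::topological_field \<Rightarrow> 'x::ab_group_add \<Rightarrow> 'x"
    and scaleY :: "'l::topological_field \<Rightarrow> 'y::ab_group_add \<Rightarrow> 'y"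
  assumes X: "vector_space scaleX" and e: "e \<noteq> 0" and \<psi>: "bij \<psi>" and f: "bij f"
    and sub: "pushforward f ` vector_topologies scaleX \<subseteq> vector_topologies scaleY"
    and semi: "\<And>a. f (scaleX a e) = scaleY (\<psi> a) v + y0"
    and Ou: "open Ou"
  shows "open (\<psi> ` Ou)"
proof -
  interpret X: vector_space scaleX by (rule X)
  obtain h where h: "Vector_Spaces.linear scaleX (*) h" "h e = 1"
    using functional_separating[OF X, of e 0] e by auto
  interpret h: Vector_Spaces.linear scaleX "(*)" h by (rule h(1))
  have T: "pushforward f (functional_top h) \<in> vector_topologies scaleY"
    using sub functional_top_vector_topology[OF h(1)] by blast
  have "f ` (h -` Ou) \<in> pushforward f (functional_top h)"
    using Ou f by (auto simp: pushforward_bij functional_top_def)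
  from vector_topology_scalars[OF T vector_topology_translate[OF T this, of y0], of v]
  have "open {b. y0 + scaleY b v \<in> f ` (h -` Ou)}" by (simp add: vimage_def)
  also have "{b. y0 + scaleY b v \<in> f ` (h -` Ou)} = \<psi> ` Ou"
  proof -
    have *: "y0 + scaleY (\<psi> a) v \<in> f ` (h -` Ou) \<longleftrightarrow> a \<in> Ou" for a
    proof -
      have "y0 + scaleY (\<psi> a) v = f (scaleX a e)" by (simp add: semi add.commute)
      then show ?thesis using f h(2) by (simp add: bij_is_inj inj_image_mem_iff h.scale)
    qed
    show ?thesis
    proof (intro set_eqI iffI)
      fix b assume b: "b \<in> {b. y0 + scaleY b v \<in> f ` (h -` Ou)}"
      obtain a where "b = \<psi> a" using \<psi> by (metis bij_pointE)
      then show "b \<in> \<psi> ` Ou" using b * by auto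
    qed (use * in auto)
  qed
  finally show ?thesis .
qed

theorem vector_topology_bijection_affine:
  fixes scaleX :: "'k::topological_field \<Rightarrow> 'x::ab_group_add \<Rightarrow> 'x"
    and scaleY :: "'l::topological_field \<Rightarrow> 'y::ab_group_add \<Rightarrow> 'y"
  assumes X: "vector_space scaleX" and Y: "vector_space scaleY" and dim: "dim_at_least 2 scaleX"
    and f: "bij f" and vt: "pushforward f ` vector_topologies scaleX = vector_topologies scaleY"
  obtains \<psi> \<phi> y0 where "topological_field_iso \<psi>" "semilinear_iso scaleX scaleY \<psi> \<phi>"
    "f = (\<lambda>x. \<phi> x + y0)"
proof -
  interpret X: vector_space scaleX by (rule X)
  interpret Y: vector_space scaleY by (rule Y)
  let ?g = "inv f"
  have g: "bij ?g" using f by (rule bij_imp_bij_inv)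
  have gf: "?g (f x) = x" "f (?g y) = y" for x y
    using f by (auto simp: bij_is_inj bij_is_surj surj_f_inv_f)
  have "pushforward ?g (pushforward f T) = T" for T
    by (simp add: pushforward_bij f g image_image gf)
  then have vt': "pushforward ?g ` vector_topologies scaleY = vector_topologies scaleX"
    by (simp flip: vt add: image_image)
  define y0 where "y0 = f 0"
  define \<phi> where "\<phi> x = f x - y0" for x
  have f\<phi>: "f x = \<phi> x + y0" for x by (simp add: \<phi>_def)
  have "inj \<phi>" using f by (auto simp: \<phi>_def inj_on_def bij_def)
  moreover have "surj \<phi>" using gf(2) by (intro surjI[of _ "\<lambda>y. ?g (y + y0)"]) (simp add: \<phi>_def)
  ultimately have \<phi>: "bij \<phi>" by (simp add: bij_def)
  have zero: "\<phi> 0 = 0" by (simp add: \<phi>_def y0_def)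
  have line: "\<exists>b. \<phi> (x + scaleX a y) = \<phi> x + scaleY b (\<phi> y)" for x y a
    using lines_into_lines[OF X Y f, of x a y 0] vt
    by (auto simp: \<phi>_def y0_def algebra_simps)
  have line': "\<exists>a. \<phi> x + scaleY b (\<phi> y) = \<phi> (x + scaleX a y)" for x y b
  proof -
    obtain a where "?g (f x + scaleY b (f y - f 0)) = x + scaleX a y"
      using lines_into_lines[OF Y X g, of "f x" b "f y" "f 0"] vt' gf by auto
    then have "f x + scaleY b (f y - f 0) = f (x + scaleX a y)" using gf by metis
    then have "\<phi> x + scaleY b (\<phi> y) = \<phi> (x + scaleX a y)"
      by (simp add: \<phi>_def y0_def algebra_simps)
    then show ?thesis by blast
  qed
  obtain \<psi> where \<psi>: "bij \<psi>" "\<psi> 1 = 1" "\<And>a b. \<psi> (a + b) = \<psi> a + \<psi> b" "\<And>a b. \<psi> (a * b) = \<psi> a * \<psi> b"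
    and semi: "semilinear_iso scaleX scaleY \<psi> \<phi>"
    using fundamental_theorem_affine_geometry[OF X Y dim \<phi> zero line line'] by metis
  obtain e :: 'x where e: "e \<noteq> 0" using dim_at_least_2D[OF X dim, of 0] X.scale_zero_right by metis
  have \<phi>e: "\<phi> e \<noteq> 0" using e zero \<phi> by (metis bij_is_inj injD)
  have \<phi>_scale: "\<phi> (scaleX a x) = scaleY (\<psi> a) (\<phi> x)" for a x
    using semi by (simp add: semilinear_iso_def)
  have "open (\<psi> ` U)" if "open U" for U
    using semilinear_open_map[OF X e \<psi>(1) f eq_refl[OF vt], of "\<phi> e" y0, OF _ that]
    by (simp add: f\<phi> \<phi>_scale)
  moreover have "open (\<psi> -` U)" if U: "open U" for U
  proof -
    \<comment> \<open>The inverse of \<open>f\<close> is affine along the line spanned by \<open>\<phi> e\<close>, with constant term \<open>?g 0\<close>.\<close>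
    have "?g (scaleY b (\<phi> e)) = scaleX (inv \<psi> b) e + ?g 0" for b
    proof -
      have "f (scaleX (inv \<psi> b) e + ?g 0) = \<phi> (scaleX (inv \<psi> b) e) + f (?g 0)"
        using semi by (simp add: f\<phi> semilinear_iso_def algebra_simps)
      also have "\<dots> = scaleY b (\<phi> e)"
        using \<psi>(1) by (simp add: \<phi>_scale gf bij_is_surj surj_f_inv_f)
      finally show ?thesis using gf by metis
    qed
    from semilinear_open_map[OF Y \<phi>e bij_imp_bij_inv[OF \<psi>(1)] g eq_refl[OF vt'] this U]
    show ?thesis using \<psi>(1) by (simp add: bij_vimage_eq_inv_image)
  qed
  ultimately have "homeomorphic_map euclidean euclidean \<psi>"
    using \<psi>(1)
    by (intro bijective_open_imp_homeomorphic_map)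
      (auto simp: open_map_def bij_def continuous_on_open_vimage)
  then have "topological_field_iso \<psi>" using \<psi> by (simp add: topological_field_iso_def)
  then show thesis using that semi f\<phi> by blast
qed

section \<open>Uniqueness\<close>

lemma complement_top_involution: "complement_top (complement_top T) = T"
proof -
  have "complement_top S = uminus ` S" for S :: "'a set set"
    by (auto simp: complement_top_def Compl_eq_Diff_UNIV)
  then show ?thesis by (simp add: image_image)
qed

text \<open>The atoms \<open>atom_top {x}\<close> already determine a bijection.\<close>

lemma pushforward_inject:
  fixes f g :: "'x \<Rightarrow> 'y"
  assumes f: "bij f" and g: "bij g" and large: "\<And>a b c. (UNIV :: 'x set) \<noteq> {a, b, c}"
    and eq: "\<And>T. T \<in> topologies \<Longrightarrow> pushforward f T = pushforward g T"
  shows "f = g"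
proof
  fix x
  have "f ` {x} \<in> pushforward f (atom_top {x})" by (simp add: pushforward_bij[OF f] atom_top_def)
  then have "f ` {x} \<in> (`) g ` atom_top {x}"
    using eq[OF atom_top_topologies] by (simp add: pushforward_bij[OF g])
  moreover have "range g \<noteq> {f x}"
  proof
    assume "range g = {f x}"
    then have "range f = f ` {x}" using f g by (simp add: bij_is_surj)
    then have "UNIV = {x}" by (rule iffD1[OF inj_image_eq_iff[OF bij_is_inj[OF f]]])
    then show False using large[of x x x] by simp
  qed
  ultimately show "f x = g x" by (auto simp: atom_top_def)
qed

text \<open>One bijection sends \<open>atom_top {x}\<close> to an atom with a one-point open set, the other
  followed by complementation to one with an open set that misses a single point. With more than two
  points these are different.\<close>

lemma pushforward_neq_complement:
  fixes f g :: "'x \<Rightarrow> 'y"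
  assumes f: "bij f" and g: "bij g" and large: "\<And>a b c. (UNIV :: 'x set) \<noteq> {a, b, c}"
  shows "\<exists>T \<in> topologies. pushforward f T \<noteq> complement_top (pushforward g T)"
proof (rule ccontr)
  assume "\<not> ?thesis"
  then have eq: "pushforward f T = complement_top (pushforward g T)" if "T \<in> topologies" for T
    using that by blast
  fix x :: 'x
  have "f ` {x} \<in> pushforward f (atom_top {x})" by (simp add: pushforward_bij[OF f] atom_top_def)
  then have "f ` {x} \<in> complement_top ((`) g ` atom_top {x})"
    using eq[OF atom_top_topologies] by (simp add: pushforward_bij[OF g])
  then have "f ` {x} = UNIV \<or> f ` {x} = - g ` {x} \<or> f ` {x} = - UNIV"
    using g by (auto simp: complement_top_def atom_top_def Compl_eq_Diff_UNIV bij_is_surj)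
  then have "f ` {x} \<union> g ` {x} = UNIV" by auto
  moreover obtain z where "g x = f z" using f by (metis bij_pointE)
  ultimately have "f ` {x, z} = f ` UNIV" using f by (simp add: bij_is_surj insert_commute)
  then have "{x, z} = UNIV" by (rule iffD1[OF inj_image_eq_iff[OF bij_is_inj[OF f]]])
  then have "UNIV = {x, z, z}" by simp
  then show False using large by blast
qed

lemma semilinear_translate_unique:
  fixes scaleX :: "'k::field \<Rightarrow> 'x::ab_group_add \<Rightarrow> 'x"
    and scaleY :: "'l::field \<Rightarrow> 'y::ab_group_add \<Rightarrow> 'y"
  assumes X: "vector_space scaleX" and Y: "vector_space scaleY" and e: "(e :: 'x) \<noteq> 0"
    and s: "semilinear_iso scaleX scaleY \<psi> \<phi>" and s': "semilinear_iso scaleX scaleY \<psi>' \<phi>'"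
    and eq: "(\<lambda>x. \<phi> x + y0) = (\<lambda>x. \<phi>' x + y0')"
  shows "\<psi> = \<psi>' \<and> \<phi> = \<phi>' \<and> y0 = y0'"
proof -
  interpret Y: vector_space scaleY by (rule Y)
  have zero: "\<phi> 0 = 0" "\<phi>' 0 = 0"
    using s s' unfolding semilinear_iso_def by (metis add_0_right add_left_cancel)+
  have y0: "y0 = y0'" using fun_cong[OF eq, of 0] zero by simp
  have \<phi>: "\<phi> = \<phi>'" using eq y0 by (auto simp: fun_eq_iff)
  have "\<phi> e \<noteq> 0" using e s zero(1) unfolding semilinear_iso_def by (metis bij_is_inj injD)
  moreover have "scaleY (\<psi> a) (\<phi> e) = scaleY (\<psi>' a) (\<phi> e)" for a
    using s s' \<phi> by (metis semilinear_iso_def)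
  ultimately have "\<psi> = \<psi>'" by (auto simp: fun_eq_iff)
  then show ?thesis using y0 \<phi> by simp
qed

lemma bij_translate: "bij \<phi> \<Longrightarrow> bij (\<lambda>x. \<phi> x + (y0 :: 'y::ab_group_add))"
  using bij_comp[of \<phi> "\<lambda>y. y + y0"] by (simp add: o_def bij_plus_right)

section \<open>Lattice isomorphisms preserving vector topologies\<close>

theorem theoremA:
  fixes scaleX :: "'k::topological_field \<Rightarrow> 'x::ab_group_add \<Rightarrow> 'x"
    and scaleY :: "'l::topological_field \<Rightarrow> 'y::ab_group_add \<Rightarrow> 'y"
    and \<Phi> :: "'x set set \<Rightarrow> 'y set set"
  assumes "vector_space scaleX"
    and "vector_space scaleY"
    and "dim_at_least 2 scaleX"
    and "topologies_lattice_iso \<Phi>"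
    and "\<Phi> ` vector_topologies scaleX = vector_topologies scaleY"
  shows "\<exists>!(\<psi>, \<phi>, y0).
    topological_field_iso (\<psi> :: 'k \<Rightarrow> 'l) \<and>
    semilinear_iso scaleX scaleY \<psi> (\<phi> :: 'x \<Rightarrow> 'y) \<and>
    (infinite (UNIV :: 'x set) \<longrightarrow>
       (\<forall>T\<in>topologies. \<Phi> T = pushforward (\<lambda>x. \<phi> x + y0) T)) \<and>
    (finite (UNIV :: 'x set) \<longrightarrow>
       (\<forall>T\<in>topologies. \<Phi> T = pushforward (\<lambda>x. \<phi> x + y0) T) \<or>
       (\<forall>T\<in>topologies. \<Phi> T = complement_top (pushforward (\<lambda>x. \<phi> x + y0) T)))"
proof -
  note X = assms(1) and Y = assms(2) and dim = assms(3)
  have large: "(UNIV :: 'x set) \<noteq> {a, b, c}" for a b c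
    by (rule dim_at_least_2_large[OF X dim])
  obtain f :: "'x \<Rightarrow> 'y" where f: "bij f" and
    cases: "(\<forall>T\<in>topologies. \<Phi> T = pushforward f T) \<or>
     finite (UNIV :: 'x set) \<and> (\<forall>T\<in>topologies. \<Phi> T = complement_top (pushforward f T))"
    using topologies_lattice_iso_cases[OF assms(4) large] by metis
  have push: "pushforward f T = \<Phi> T" if T: "T \<in> vector_topologies scaleX" for T
    using cases
  proof
    assume fin: "finite (UNIV :: 'x set) \<and> (\<forall>T\<in>topologies. \<Phi> T = complement_top (pushforward f T))"
    have "finite (UNIV :: 'y set)" using fin bij_betw_finite[OF f] by blast
    moreover have "\<Phi> T \<in> vector_topologies scaleY" using assms(5) T by blast
    ultimately have "\<Phi> T = complement_top (\<Phi> T)"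
      using complement_vector_topology_finite[OF Y] by metis
    then show ?thesis
      using fin vector_topologies_topologies[OF T] by (simp add: complement_top_involution)
  qed (use vector_topologies_topologies[OF T] in simp)
  then have "pushforward f ` vector_topologies scaleX = vector_topologies scaleY"
    using assms(5) by (simp cong: image_cong)
  then obtain \<psi> \<phi> y0 where iso: "topological_field_iso \<psi>" "semilinear_iso scaleX scaleY \<psi> \<phi>"
    and f_eq: "f = (\<lambda>x. \<phi> x + y0)"
    using vector_topology_bijection_affine[OF X Y dim f] by metis
  obtain e :: 'x where e: "e \<noteq> 0" using large[of 0 0 0] by auto
  show ?thesis
  proof (rule ex1I[of _ "(\<psi>, \<phi>, y0)"], goal_cases)
    case 1
    then show ?case using iso cases unfolding f_eq by blast
  next
    case (2 p)
    obtain \<psi>' \<phi>' y0' where p: "p = (\<psi>', \<phi>', y0')" by (cases p)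
    define g where "g x = \<phi>' x + y0'" for x
    have s': "semilinear_iso scaleX scaleY \<psi>' \<phi>'" using 2 p by simp
    then have g: "bij g" unfolding g_def by (intro bij_translate) (simp add: semilinear_iso_def)
    have "(\<forall>T\<in>topologies. \<Phi> T = pushforward g T) \<or>
        (\<forall>T\<in>topologies. \<Phi> T = complement_top (pushforward g T))"
      using 2 p unfolding g_def by auto
    then have "\<forall>T\<in>topologies. pushforward f T = pushforward g T"
    proof
      assume g': "\<forall>T\<in>topologies. \<Phi> T = pushforward g T"
      then show ?thesis
        using cases pushforward_neq_complement[OF g f large] by metis
    next
      assume g': "\<forall>T\<in>topologies. \<Phi> T = complement_top (pushforward g T)"
      then show ?thesis
        using cases pushforward_neq_complement[OF f g large] complement_top_involution by metis
    qed
    then have "f = g" using pushforward_inject[OF f g large] by blast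
    then have "(\<lambda>x. \<phi> x + y0) = (\<lambda>x. \<phi>' x + y0')" unfolding f_eq g_def fun_eq_iff by blast
    from semilinear_translate_unique[OF X Y e iso(2) s' this]
    show ?case using p by simp
  qed
qed

end
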